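(* Let $F>0$ and suppose that $$\phi''_{F}>0,\ \phi''_{2F}<0,\quad \rho'_{F}\le 0,\ \rho'_{2F}\le 0,\quad \rho''_{F}\ge 0,\ \rho''_{2F}\ge 0,\quad G''_{F}\ge 0,$$ and that $B_F<0$. Then there are an integer $N_0$ and a constant $K$ (independent of $N$) such that for all $N\ge N_0$, with $\epsilon=1/N$: the number $\lambda^a_F(s_1)$ is not the minimum eigenvalue of the second variation $\delta^2\mathcal{E}^a(\mathbf{y}_F)$ with respect to the norm $\|D\mathbf{u}\|_{\ell^2_\epsilon}$. Instead, the minimum eigenvalue equals $\lambda^a_F(s_{k^*})$ for some $1<k^*\le N$ such that either $s_{k^*}=4$, or $$s^*:=\frac{C_F-\sqrt{C_F^2-3B_FD_F}}{-3D_F}$$ is well defined (i.e. $D_F\neq 0$ and $C_F^2-3B_FD_F\ge0$) and $|s_{k^*}-s^*|\le K\cdot 2k^*\epsilon^2$.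
   Context: Fix smooth functions $\phi,\rho:(0,\infty)\to\mathbb{R}$ (pair potential, electron density) and $G:\mathbb{R}\to\mathbb{R}$ (embedding function) and $F>0$. For an integer $N\ge1$ let $\epsilon=1/N$. Let $\mathcal{U}$ be the space of real sequences $\mathbf{u}=(u_\ell)_{\ell\in\mathbb{Z}}$ with $u_{\ell+2N}=u_\ell$ and $\sum_{\ell=-N+1}^N u_\ell=0$. Let $(\mathbf{y}_F)_\ell=F\epsilon\ell$ and $\mathcal{Y}_F=\{\mathbf{y}_F+\mathbf{u}:\mathbf{u}\in\mathcal{U}\}$. For a sequence $\mathbf{y}$ put $y'_\ell=(D\mathbf{y})_\ell=(y_\ell-y_{\ell-1})/\epsilon$, and $\|D\mathbf{u}\|_{\ell^2_\epsilon}=\big(\epsilon\sum_{\ell=-N+1}^N|u'_\ell|^2\big)^{1/2}$. Atomistic (next-nearest neighbour EAM) energy: for $\mathbf{y}\in\mathcal{Y}_F$ (near $\mathbf{y}_F$), $$\mathcal{E}^a(\mathbf{y})=\epsilon\sum_{\ell=-N+1}^N\Big\{G\big(\bar\rho^a_\ell(\mathbf{y})\big)+\tfrac12\big[\phi(y'_\ell)+\phi(y'_\ell+y'_{\ell-1})+\phi(y'_{\ell+1})+\phi(y'_{\ell+1}+y'_{\ell+2})\big]\Big\},$$ $$\bar\rho^a_\ell(\mathbf{y})=\rho(y'_\ell)+\rho(y'_\ell+y'_{\ell-1})+\rho(y'_{\ell+1})+\rho(y'_{\ell+1}+y'_{\ell+2}).$$ The second variation is the quadratic form $\langle\delta^2\mathcal{E}^a(\mathbf{y}_F)\mathbf{u},\mathbf{u}\rangle=\frac{d^2}{dt^2}\mathcal{E}^a(\mathbf{y}_F+t\mathbf{u})\big|_{t=0}$,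 $\mathbf{u}\in\mathcal{U}$. Its minimum eigenvalue with respect to $\|D\mathbf{u}\|_{\ell^2_\epsilon}$ is $\min\{\langle\delta^2\mathcal{E}^a(\mathbf{y}_F)\mathbf{u},\mathbf{u}\rangle:\mathbf{u}\in\mathcal{U},\ \|D\mathbf{u}\|_{\ell^2_\epsilon}=1\}$. Notation: $\phi''_F=\phi''(F)$, $\phi''_{2F}=\phi''(2F)$, $\rho'_F=\rho'(F)$, $\rho'_{2F}=\rho'(2F)$, $\rho''_F=\rho''(F)$, $\rho''_{2F}=\rho''(2F)$, and $G'_F=G'(\bar\rho_F)$, $G''_F=G''(\bar\rho_F)$ with $\bar\rho_F=2\rho(F)+2\rho(2F)$. Put $$A_F=4G''_F(\rho'_F+2\rho'_{2F})^2+2G'_F(\rho''_F+4\rho''_{2F})+\phi''_F+4\phi''_{2F},$$ $$B_F=-\big[\phi''_{2F}+G''_F\big((\rho'_F)^2+20(\rho'_{2F})^2+12\rho'_F\rho'_{2F}\big)+2G'_F\rho''_{2F}\big],$$ $$C_F=G''_F\big(8(\rho'_{2F})^2+2\rho'_F\rho'_{2F}\big),\qquad D_F=-G''_F(\rho'_{2F})^2,$$ $\lambda^a_F(s)=A_F+B_Fs+C_Fs^2+D_Fs^3$, and $s_k=4\sin^2(k\pi/(2N))$ for $k=1,\dots,N$. *)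

theory Defs
  imports "HOL-Analysis.Analysis"
begin

text \<open>
  The functions on the half-line \<open>(0,\<infinity>)\<close> are total functions here; only their values
  on \<open>{0<..}\<close> are constrained.  For open \<open>S\<close> the iterated derivatives on \<open>S\<close> depend only on
  the restriction to \<open>S\<close>.
\<close>

definition smooth_fun_on :: "real set \<Rightarrow> (real \<Rightarrow> real) \<Rightarrow> bool" where
  "smooth_fun_on S f \<longleftrightarrow> (\<forall>n. \<forall>x\<in>S. (deriv ^^ n) f differentiable (at x))"

definition lattice_eps :: "nat \<Rightarrow> real" where
  "lattice_eps N = 1 / real N"

definition cell :: "nat \<Rightarrow> int set" where
  "cell N = {- int N + 1..int N}"

definition displacements :: "nat \<Rightarrow> (int \<Rightarrow> real) set" where
  "displacements N =
     {u. (\<forall>l. u (l + 2 * int N) = u l) \<and> (\<Sum>l\<in>cell N. u l) = 0}"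

definition uniform_deformation :: "real \<Rightarrow> nat \<Rightarrow> int \<Rightarrow> real" where
  "uniform_deformation F N l = F * lattice_eps N * of_int l"

definition bdiff :: "nat \<Rightarrow> (int \<Rightarrow> real) \<Rightarrow> int \<Rightarrow> real" where
  "bdiff N y l = (y l - y (l - 1)) / lattice_eps N"

definition l2_eps_norm :: "nat \<Rightarrow> (int \<Rightarrow> real) \<Rightarrow> real" where
  "l2_eps_norm N v = sqrt (lattice_eps N * (\<Sum>l\<in>cell N. \<bar>v l\<bar>\<^sup>2))"

definition rho_bar_a :: "(real \<Rightarrow> real) \<Rightarrow> nat \<Rightarrow> (int \<Rightarrow> real) \<Rightarrow> int \<Rightarrow> real" where
  "rho_bar_a \<rho> N y l =
     \<rho> (bdiff N y l) + \<rho> (bdiff N y l + bdiff N y (l - 1))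
     + \<rho> (bdiff N y (l + 1)) + \<rho> (bdiff N y (l + 1) + bdiff N y (l + 2))"

definition energy_a ::
  "(real \<Rightarrow> real) \<Rightarrow> (real \<Rightarrow> real) \<Rightarrow> (real \<Rightarrow> real) \<Rightarrow> nat \<Rightarrow> (int \<Rightarrow> real) \<Rightarrow> real" where
  "energy_a \<phi> \<rho> G N y = lattice_eps N * (\<Sum>l\<in>cell N.
     G (rho_bar_a \<rho> N y l)
     + 1 / 2 * (\<phi> (bdiff N y l) + \<phi> (bdiff N y l + bdiff N y (l - 1))
                + \<phi> (bdiff N y (l + 1)) + \<phi> (bdiff N y (l + 1) + bdiff N y (l + 2))))"

definition second_variation_a ::
  "(real \<Rightarrow> real) \<Rightarrow> (real \<Rightarrow> real) \<Rightarrow> (real \<Rightarrow> real) \<Rightarrow> real \<Rightarrow> nat \<Rightarrow> (int \<Rightarrow> real) \<Rightarrow> real" where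
  "second_variation_a \<phi> \<rho> G F N u =
     (deriv ^^ 2) (\<lambda>t. energy_a \<phi> \<rho> G N (\<lambda>l. uniform_deformation F N l + t * u l)) 0"

text \<open>
  A relation rather than a function, so that asserting it includes that the minimum is attained.
\<close>

definition is_min_eigenvalue_a ::
  "(real \<Rightarrow> real) \<Rightarrow> (real \<Rightarrow> real) \<Rightarrow> (real \<Rightarrow> real) \<Rightarrow> real \<Rightarrow> nat \<Rightarrow> real \<Rightarrow> bool" where
  "is_min_eigenvalue_a \<phi> \<rho> G F N \<mu> \<longleftrightarrow>
     (let V = second_variation_a \<phi> \<rho> G F N `
                {u \<in> displacements N. l2_eps_norm N (bdiff N u) = 1}
      in \<mu> \<in> V \<and> (\<forall>v\<in>V. \<mu> \<le> v))"

definition rho_bar_F :: "(real \<Rightarrow> real) \<Rightarrow> real \<Rightarrow> real" where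
  "rho_bar_F \<rho> F = 2 * \<rho> F + 2 * \<rho> (2 * F)"

definition A_coeff :: "(real \<Rightarrow> real) \<Rightarrow> (real \<Rightarrow> real) \<Rightarrow> (real \<Rightarrow> real) \<Rightarrow> real \<Rightarrow> real" where
  "A_coeff \<phi> \<rho> G F =
     4 * (deriv ^^ 2) G (rho_bar_F \<rho> F) * (deriv \<rho> F + 2 * deriv \<rho> (2 * F))\<^sup>2
     + 2 * deriv G (rho_bar_F \<rho> F) * ((deriv ^^ 2) \<rho> F + 4 * (deriv ^^ 2) \<rho> (2 * F))
     + (deriv ^^ 2) \<phi> F + 4 * (deriv ^^ 2) \<phi> (2 * F)"

definition B_coeff :: "(real \<Rightarrow> real) \<Rightarrow> (real \<Rightarrow> real) \<Rightarrow> (real \<Rightarrow> real) \<Rightarrow> real \<Rightarrow> real" where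
  "B_coeff \<phi> \<rho> G F =
     - ((deriv ^^ 2) \<phi> (2 * F)
        + (deriv ^^ 2) G (rho_bar_F \<rho> F)
          * ((deriv \<rho> F)\<^sup>2 + 20 * (deriv \<rho> (2 * F))\<^sup>2 + 12 * deriv \<rho> F * deriv \<rho> (2 * F))
        + 2 * deriv G (rho_bar_F \<rho> F) * (deriv ^^ 2) \<rho> (2 * F))"

definition C_coeff :: "(real \<Rightarrow> real) \<Rightarrow> (real \<Rightarrow> real) \<Rightarrow> real \<Rightarrow> real" where
  "C_coeff \<rho> G F =
     (deriv ^^ 2) G (rho_bar_F \<rho> F)
     * (8 * (deriv \<rho> (2 * F))\<^sup>2 + 2 * deriv \<rho> F * deriv \<rho> (2 * F))"

definition D_coeff :: "(real \<Rightarrow> real) \<Rightarrow> (real \<Rightarrow> real) \<Rightarrow> real \<Rightarrow> real" where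
  "D_coeff \<rho> G F = - (deriv ^^ 2) G (rho_bar_F \<rho> F) * (deriv \<rho> (2 * F))\<^sup>2"

definition lambda_a ::
  "(real \<Rightarrow> real) \<Rightarrow> (real \<Rightarrow> real) \<Rightarrow> (real \<Rightarrow> real) \<Rightarrow> real \<Rightarrow> real \<Rightarrow> real" where
  "lambda_a \<phi> \<rho> G F s =
     A_coeff \<phi> \<rho> G F + B_coeff \<phi> \<rho> G F * s + C_coeff \<rho> G F * s\<^sup>2 + D_coeff \<rho> G F * s ^ 3"

definition s_freq :: "nat \<Rightarrow> nat \<Rightarrow> real" where
  "s_freq N k = 4 * (sin (real k * pi / (2 * real N)))\<^sup>2"

definition discr :: "(real \<Rightarrow> real) \<Rightarrow> (real \<Rightarrow> real) \<Rightarrow> (real \<Rightarrow> real) \<Rightarrow> real \<Rightarrow> real" where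
  "discr \<phi> \<rho> G F = (C_coeff \<rho> G F)\<^sup>2 - 3 * B_coeff \<phi> \<rho> G F * D_coeff \<rho> G F"

text \<open>Meaningful only if \<open>D_coeff \<rho> G F \<noteq> 0\<close> and \<open>discr \<phi> \<rho> G F \<ge> 0\<close>.\<close>

definition s_star :: "(real \<Rightarrow> real) \<Rightarrow> (real \<Rightarrow> real) \<Rightarrow> (real \<Rightarrow> real) \<Rightarrow> real \<Rightarrow> real" where
  "s_star \<phi> \<rho> G F =
     (C_coeff \<rho> G F - sqrt (discr \<phi> \<rho> G F)) / (- 3 * D_coeff \<rho> G F)"

end

theory Submission
  imports Defs
begin

text \<open>
  In terms of the strain \<open>w = bdiff N u\<close> the second variation is a translation invariant
  quadratic form on periodic mean-zero sequences.  The discrete Fourier transform diagonalises it,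
  with eigenvalues \<open>\<lambda>(s\<^sub>k)\<close>, so the minimum eigenvalue is the least value of the cubic \<open>\<lambda>\<close> on the
  grid \<open>s\<^sub>1 < \<dots> < s\<^sub>N = 4\<close>.  As \<open>\<lambda>\<close> decreases near 0 and \<open>s\<^sub>2 \<rightarrow> 0\<close>, the least value is not
  taken at \<open>s\<^sub>1\<close> once \<open>N\<close> is large.  If it is taken at an interior grid point \<open>s\<^sub>k\<close>, then the shape of
  a cubic with negative leading coefficient forces its local minimum \<open>s\<^sup>*\<close> to lie between the two
  neighbouring grid points, whose distance to \<open>s\<^sub>k\<close> is of order \<open>k / N\<^sup>2\<close>.
\<close>

section \<open>Second derivatives along a line\<close>

lemma smooth_fun_on_deriv:
  assumes "smooth_fun_on S f" "x \<in> S"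
  shows "(f has_real_derivative deriv f x) (at x)"
    and "(deriv f has_real_derivative (deriv ^^ 2) f x) (at x)"
proof -
  have *: "(deriv ^^ n) f differentiable (at x)" for n
    using assms by (auto simp: smooth_fun_on_def)
  show "(f has_real_derivative deriv f x) (at x)"
    using *[of 0] by (simp add: DERIV_deriv_iff_real_differentiable)
  show "(deriv f has_real_derivative (deriv ^^ 2) f x) (at x)"
    using *[of 1] by (simp add: DERIV_deriv_iff_real_differentiable numeral_2_eq_2)
qed

text \<open>An iterated \<open>deriv\<close> at \<open>a\<close> can only be evaluated if the first
  derivative is known on a whole neighbourhood of \<open>a\<close>, hence the function
  \<open>g\<close> and the filter \<open>nhds a\<close>. In this form second derivatives are
  computed by sum and chain rules.\<close>

definition has_two_jet :: "(real \<Rightarrow> real) \<Rightarrow> real \<Rightarrow> real \<Rightarrow> real \<Rightarrow> bool" where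
  "has_two_jet f a f1 f2 \<longleftrightarrow>
     (\<exists>g. (\<forall>\<^sub>F t in nhds a. (f has_real_derivative g t) (at t)) \<and> g a = f1 \<and>
          (g has_real_derivative f2) (at a))"

lemma has_two_jet_deriv:
  assumes "has_two_jet f a f1 f2"
  shows "(deriv ^^ 2) f a = f2"
proof -
  obtain g where ev: "\<forall>\<^sub>F t in nhds a. (f has_real_derivative g t) (at t)"
    and g: "(g has_real_derivative f2) (at a)"
    using assms by (auto simp: has_two_jet_def)
  have "\<forall>\<^sub>F t in nhds a. deriv f t = g t"
    using ev by eventually_elim (rule DERIV_imp_deriv)
  then have "deriv (deriv f) a = deriv g a"
    by (rule deriv_cong_ev) simp
  with g show ?thesis by (simp add: numeral_2_eq_2 DERIV_imp_deriv)
qed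

lemma has_two_jet_affine: "has_two_jet (\<lambda>t. c + t * b) a b 0"
  unfolding has_two_jet_def
  by (rule exI[of _ "\<lambda>_. b"]) (auto intro!: derivative_eq_intros always_eventually)

lemma has_two_jet_const: "has_two_jet (\<lambda>t. c) a 0 0"
  unfolding has_two_jet_def
  by (rule exI[of _ "\<lambda>_. 0"]) (auto intro!: derivative_eq_intros always_eventually)

lemma has_two_jet_add:
  assumes "has_two_jet f a f1 f2" "has_two_jet g a g1 g2"
  shows "has_two_jet (\<lambda>t. f t + g t) a (f1 + g1) (f2 + g2)"
proof -
  obtain f' where f: "\<forall>\<^sub>F t in nhds a. (f has_real_derivative f' t) (at t)"
    "f' a = f1" "(f' has_real_derivative f2) (at a)"
    using assms(1) by (auto simp: has_two_jet_def)
  obtain g' where g: "\<forall>\<^sub>F t in nhds a. (g has_real_derivative g' t) (at t)"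
    "g' a = g1" "(g' has_real_derivative g2) (at a)"
    using assms(2) by (auto simp: has_two_jet_def)
  have "\<forall>\<^sub>F t in nhds a. ((\<lambda>t. f t + g t) has_real_derivative f' t + g' t) (at t)"
    using f(1) g(1) by eventually_elim (rule DERIV_add)
  moreover have "((\<lambda>t. f' t + g' t) has_real_derivative f2 + g2) (at a)"
    using f(3) g(3) by (rule DERIV_add)
  ultimately show ?thesis
    unfolding has_two_jet_def using f(2) g(2) by (intro exI[of _ "\<lambda>t. f' t + g' t"]) auto
qed

text \<open>Second order chain rule. By continuity, \<open>r t\<close> stays in the open set
  \<open>S\<close> for \<open>t\<close> near \<open>a\<close>, so smoothness of \<open>f\<close> on
  \<open>S\<close> alone is enough; this covers potentials constrained only on the
  half-line.\<close>

lemma has_two_jet_compose: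
  assumes r: "has_two_jet r a r1 r2" and S: "open S" "r a \<in> S" and f: "smooth_fun_on S f"
  shows "has_two_jet (\<lambda>t. f (r t)) a (deriv f (r a) * r1)
           ((deriv ^^ 2) f (r a) * r1\<^sup>2 + deriv f (r a) * r2)"
proof -
  obtain r' where r: "\<forall>\<^sub>F t in nhds a. (r has_real_derivative r' t) (at t)"
    "r' a = r1" "(r' has_real_derivative r2) (at a)"
    using r by (auto simp: has_two_jet_def)
  have ra: "(r has_real_derivative r1) (at a)"
    using eventually_nhds_x_imp_x[OF r(1)] r(2) by simp
  then have "isCont r a" by (rule DERIV_isCont)
  then have "filterlim r (nhds (r a)) (nhds a)"
    by (simp add: continuous_at tendsto_nhds_iff)
  then have "\<forall>\<^sub>F t in nhds a. r t \<in> S"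
    using S by (simp add: topological_tendstoD)
  with r(1) have "\<forall>\<^sub>F t in nhds a.
      ((\<lambda>t. f (r t)) has_real_derivative deriv f (r t) * r' t) (at t)"
    by eventually_elim (rule DERIV_chain2[OF smooth_fun_on_deriv(1)[OF f]])
  moreover have "((\<lambda>t. deriv f (r t) * r' t) has_real_derivative
      (deriv ^^ 2) f (r a) * r1\<^sup>2 + deriv f (r a) * r2) (at a)"
    using DERIV_mult[OF DERIV_chain2[OF smooth_fun_on_deriv(2)[OF f S(2)] ra] r(3)] r(2)
    by (simp add: power2_eq_square algebra_simps)
  ultimately show ?thesis
    unfolding has_two_jet_def using r(2)
    by (intro exI[of _ "\<lambda>t. deriv f (r t) * r' t"]) auto
qed

lemma has_two_jet_cmult:
  assumes "has_two_jet f a f1 f2"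
  shows "has_two_jet (\<lambda>t. c * f t) a (c * f1) (c * f2)"
proof -
  obtain f' where f: "\<forall>\<^sub>F t in nhds a. (f has_real_derivative f' t) (at t)"
    "f' a = f1" "(f' has_real_derivative f2) (at a)"
    using assms(1) by (auto simp: has_two_jet_def)
  have "\<forall>\<^sub>F t in nhds a. ((\<lambda>t. c * f t) has_real_derivative c * f' t) (at t)"
    using f(1) by eventually_elim (rule DERIV_cmult)
  moreover have "((\<lambda>t. c * f' t) has_real_derivative c * f2) (at a)"
    using f(3) by (rule DERIV_cmult)
  ultimately show ?thesis
    unfolding has_two_jet_def using f(2) by (intro exI[of _ "\<lambda>t. c * f' t"]) auto
qed

lemma has_two_jet_sum:
  assumes "\<And>i. i \<in> I \<Longrightarrow> has_two_jet (f i) a (f1 i) (f2 i)"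
  shows "has_two_jet (\<lambda>t. \<Sum>i\<in>I. f i t) a (\<Sum>i\<in>I. f1 i) (\<Sum>i\<in>I. f2 i)"
  using assms
  by (induction I rule: infinite_finite_induct)
     (simp_all add: has_two_jet_const has_two_jet_add)

section \<open>The second variation as a quadratic form in the strain\<close>

lemma bdiff_uniform_deformation_add:
  assumes "N \<ge> 1"
  shows "bdiff N (\<lambda>l. uniform_deformation F N l + t * u l) l = F + t * bdiff N u l"
  using assms
  by (simp add: bdiff_def uniform_deformation_def lattice_eps_def field_simps)

lemma second_variation_a_eq:
  fixes \<phi> \<rho> G :: "real \<Rightarrow> real" and u :: "int \<Rightarrow> real"
  assumes "smooth_fun_on {0<..} \<phi>" "smooth_fun_on {0<..} \<rho>" "smooth_fun_on UNIV G"
    and F: "F > 0" and N: "N \<ge> 1"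
  defines "w \<equiv> bdiff N u"
  shows "second_variation_a \<phi> \<rho> G F N u = lattice_eps N * (\<Sum>l\<in>cell N.
      (deriv ^^ 2) G (rho_bar_F \<rho> F) *
        (deriv \<rho> F * (w l + w (l + 1))
         + deriv \<rho> (2 * F) * (w (l - 1) + w l + w (l + 1) + w (l + 2)))\<^sup>2
      + deriv G (rho_bar_F \<rho> F) *
        ((deriv ^^ 2) \<rho> F * ((w l)\<^sup>2 + (w (l + 1))\<^sup>2)
         + (deriv ^^ 2) \<rho> (2 * F) * ((w l + w (l - 1))\<^sup>2 + (w (l + 1) + w (l + 2))\<^sup>2))
      + 1 / 2 *
        ((deriv ^^ 2) \<phi> F * ((w l)\<^sup>2 + (w (l + 1))\<^sup>2)
         + (deriv ^^ 2) \<phi> (2 * F) * ((w l + w (l - 1))\<^sup>2 + (w (l + 1) + w (l + 2))\<^sup>2)))"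
    (is "_ = _ * (\<Sum>l\<in>cell N. ?q l)")
proof -
  \<comment> \<open>The strain is affine in \<open>t\<close>, so the chain rule leaves only the term
    with the second derivative of \<open>h\<close>. For \<open>G\<close> below, the inner density
    has curvature of its own and both terms survive.\<close>
  have jet1: "has_two_jet (\<lambda>t. h (F + t * b)) 0 (deriv h F * b) ((deriv ^^ 2) h F * b\<^sup>2)"
    if "smooth_fun_on {0<..} h" for h b
    using has_two_jet_compose[OF has_two_jet_affine[of F b 0], of "{0<..}" h] that F by simp
  have jet2: "has_two_jet (\<lambda>t. h ((F + t * b) + (F + t * c))) 0
      (deriv h (2 * F) * (b + c)) ((deriv ^^ 2) h (2 * F) * (b + c)\<^sup>2)"
    if "smooth_fun_on {0<..} h" for h b c
    using has_two_jet_compose[OF has_two_jet_affine[of "2 * F" "b + c" 0], of "{0<..}" h] that F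
    by (simp add: algebra_simps)
  let ?S = "\<lambda>h l t. h (F + t * w l) + h ((F + t * w l) + (F + t * w (l - 1)))
                   + h (F + t * w (l + 1)) + h ((F + t * w (l + 1)) + (F + t * w (l + 2)))"
  let ?S1 = "\<lambda>h l. deriv h F * w l + deriv h (2 * F) * (w l + w (l - 1))
                   + deriv h F * w (l + 1) + deriv h (2 * F) * (w (l + 1) + w (l + 2))"
  let ?S2 = "\<lambda>h l. (deriv ^^ 2) h F * (w l)\<^sup>2 + (deriv ^^ 2) h (2 * F) * (w l + w (l - 1))\<^sup>2
                   + (deriv ^^ 2) h F * (w (l + 1))\<^sup>2
                   + (deriv ^^ 2) h (2 * F) * (w (l + 1) + w (l + 2))\<^sup>2"
  have S: "has_two_jet (?S h l) 0 (?S1 h l) (?S2 h l)" if "smooth_fun_on {0<..} h" for h l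
    by (intro has_two_jet_add jet1 jet2 that)
  have S1: "?S1 h l = deriv h F * (w l + w (l + 1))
      + deriv h (2 * F) * (w (l - 1) + w l + w (l + 1) + w (l + 2))" for h l
    by (simp add: algebra_simps)
  have S2: "?S2 h l = (deriv ^^ 2) h F * ((w l)\<^sup>2 + (w (l + 1))\<^sup>2)
      + (deriv ^^ 2) h (2 * F) * ((w l + w (l - 1))\<^sup>2 + (w (l + 1) + w (l + 2))\<^sup>2)" for h l
    by (simp add: distrib_left)
  \<comment> \<open>At \<open>t = 0\<close> every site sees the same density, so the derivatives of
    \<open>G\<close> are the same constants for all \<open>l\<close>.\<close>
  have S0: "?S \<rho> l 0 = rho_bar_F \<rho> F" for l
    by (simp add: rho_bar_F_def)
  have G: "has_two_jet (\<lambda>t. G (?S \<rho> l t)) 0 (deriv G (rho_bar_F \<rho> F) * ?S1 \<rho> l)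
     ((deriv ^^ 2) G (rho_bar_F \<rho> F) * (?S1 \<rho> l)\<^sup>2 + deriv G (rho_bar_F \<rho> F) * ?S2 \<rho> l)" for l
    using has_two_jet_compose[OF S[OF assms(2), of l] open_UNIV UNIV_I assms(3)]
    by (simp only: S0)
  have "has_two_jet (\<lambda>t. lattice_eps N * (\<Sum>l\<in>cell N. G (?S \<rho> l t) + 1 / 2 * ?S \<phi> l t)) 0
     (lattice_eps N * (\<Sum>l\<in>cell N. deriv G (rho_bar_F \<rho> F) * ?S1 \<rho> l + 1 / 2 * ?S1 \<phi> l))
     (lattice_eps N * (\<Sum>l\<in>cell N.
       ((deriv ^^ 2) G (rho_bar_F \<rho> F) * (?S1 \<rho> l)\<^sup>2 + deriv G (rho_bar_F \<rho> F) * ?S2 \<rho> l)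
       + 1 / 2 * ?S2 \<phi> l))"
    by (intro has_two_jet_cmult has_two_jet_sum has_two_jet_add G S[OF assms(1)])
  from has_two_jet_deriv[OF this]
  have "second_variation_a \<phi> \<rho> G F N u = lattice_eps N * (\<Sum>l\<in>cell N.
       ((deriv ^^ 2) G (rho_bar_F \<rho> F) * (?S1 \<rho> l)\<^sup>2 + deriv G (rho_bar_F \<rho> F) * ?S2 \<rho> l)
       + 1 / 2 * ?S2 \<phi> l)"
    unfolding second_variation_a_def energy_a_def rho_bar_a_def
      bdiff_uniform_deformation_add[OF N] w_def .
  also have "\<dots> = lattice_eps N * (\<Sum>l\<in>cell N. ?q l)"
    unfolding S1 S2 ..
  finally show ?thesis .
qed

section \<open>Discrete Fourier transform and the quadratic form\<close>

text \<open>The cell is exactly one period: a shift by one trades the term at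
  \<open>- int N + 1\<close> for the one at \<open>int N + 1\<close>, and periodicity identifies the
  two.\<close>

lemma sum_cell_shift:
  fixes f :: "int \<Rightarrow> 'a::comm_monoid_add"
  assumes "\<And>l. f (l + 2 * int N) = f l"
  shows "(\<Sum>l\<in>cell N. f (l + 1)) = (\<Sum>l\<in>cell N. f l)"
proof (cases "N = 0")
  case True
  then show ?thesis by (simp add: cell_def)
next
  case False
  let ?I = "{- int N + 2..int N}"
  have "(\<Sum>l\<in>cell N. f (l + 1)) = (\<Sum>l\<in>{- int N + 2..int N + 1}. f l)"
    by (rule sum.reindex_bij_witness[of _ "\<lambda>l. l - 1" "\<lambda>l. l + 1"]) (auto simp: cell_def)
  also have "{- int N + 2..int N + 1} = insert (int N + 1) ?I" using False by auto
  also have "(\<Sum>l\<in>\<dots>. f l) = f (int N + 1) + sum f ?I" by simp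
  also have "f (int N + 1) = f (- int N + 1)" using assms[of "- int N + 1"] by simp
  also have "f (- int N + 1) + sum f ?I = sum f (insert (- int N + 1) ?I)" by simp
  also have "insert (- int N + 1) ?I = cell N" using False by (auto simp: cell_def)
  finally show ?thesis .
qed

definition periodic_seq :: "nat \<Rightarrow> (int \<Rightarrow> 'a) \<Rightarrow> bool" where
  "periodic_seq N w \<longleftrightarrow> (\<forall>l. w (l + 2 * int N) = w l)"

lemma periodic_seq_shift: "periodic_seq N w \<Longrightarrow> periodic_seq N (\<lambda>l. w (l + c))"
  unfolding periodic_seq_def by (metis add.assoc add.commute)

text \<open>The period is \<open>2 * N\<close>, so the angle \<open>pi * k / N\<close> is the usual
  \<open>2 * pi * k / (2 * N)\<close>. There is no normalising factor; \<open>2 * real N\<close>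
  appears in Parseval's identity instead.\<close>

definition dft :: "nat \<Rightarrow> (int \<Rightarrow> real) \<Rightarrow> nat \<Rightarrow> complex" where
  "dft N w k = (\<Sum>l\<in>cell N. of_real (w l) * cis (- (pi * real k * of_int l / real N)))"

lemma dft_add: "dft N (\<lambda>l. v l + w l) k = dft N v k + dft N w k"
  by (simp add: dft_def algebra_simps sum.distrib)

lemma dft_cmult: "dft N (\<lambda>l. c * w l) k = of_real c * dft N w k"
  by (simp add: dft_def sum_distrib_left mult.assoc)

text \<open>The sequence and the exponential both have period \<open>2 * N\<close>, so the sum may
  be re-indexed by one, at the cost of a phase.\<close>

lemma dft_shift:
  assumes "N \<ge> 1" "periodic_seq N w"
  shows "dft N (\<lambda>l. w (l + 1)) k = cis (pi * real k / real N) * dft N w k"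
proof -
  let ?e = "\<lambda>l::int. cis (- (pi * real k * of_int l / real N))"
  have per: "?e (l + 2 * int N) = ?e l" for l
  proof -
    have "- (pi * real k * of_int (l + 2 * int N) / real N)
        = - (pi * real k * of_int l / real N) + 2 * pi * (- real k)"
      using assms(1) by (simp add: field_simps)
    then have "?e (l + 2 * int N) = ?e l * cis (2 * pi * (- real k))"
      by (simp only: cis_mult)
    also have "cis (2 * pi * (- real k)) = 1"
      by (rule cis_multiple_2pi) simp
    finally show ?thesis by simp
  qed
  have e: "cis (pi * real k / real N) * ?e (l + 1) = ?e l" for l
  proof -
    have "pi * real k / real N + - (pi * real k * of_int (l + 1) / real N)
        = - (pi * real k * of_int l / real N)"
      by (simp add: distrib_left add_divide_distrib)
    then show ?thesis by (simp only: cis_mult)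
  qed
  have "cis (pi * real k / real N) * dft N w k
      = cis (pi * real k / real N) * (\<Sum>l\<in>cell N. of_real (w (l + 1)) * ?e (l + 1))"
    unfolding dft_def using assms(2)
    by (subst sum_cell_shift[of "\<lambda>l. of_real (w l) * ?e l"]) (simp_all add: per periodic_seq_def del: of_int_add)
  also have "\<dots> = (\<Sum>l\<in>cell N. of_real (w (l + 1)) * (cis (pi * real k / real N) * ?e (l + 1)))"
    by (simp add: sum_distrib_left mult.left_commute del: of_int_add)
  also have "\<dots> = dft N (\<lambda>l. w (l + 1)) k"
    unfolding e dft_def ..
  finally show ?thesis ..
qed

text \<open>Expand the squared modulus into a double sum over \<open>l\<close> and \<open>m\<close>
  and sum over \<open>k\<close> first: the sum of powers of a root of unity vanishes unless
  \<open>l = m\<close>.\<close>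

lemma dft_parseval:
  assumes "N \<ge> 1"
  shows "(\<Sum>k<2 * N. (cmod (dft N w k))\<^sup>2) = 2 * real N * (\<Sum>l\<in>cell N. (w l)\<^sup>2)"
proof -
  have fin: "finite (cell N)" by (simp add: cell_def)
  \<comment> \<open>The bound on \<open>d\<close> holds for differences of two cell points and makes
    \<open>d = 0\<close> the only multiple of \<open>2 * N\<close>, so any other \<open>d\<close>
    gives a nontrivial root of unity.\<close>
  have geo: "(\<Sum>k<2 * N. cis (pi * real k * of_int d / real N)) = (if d = 0 then of_nat (2 * N) else 0)"
    if "\<bar>d\<bar> < 2 * int N" for d :: int
  proof (cases "d = 0")
    case True
    then show ?thesis by simp
  next
    case False
    let ?z = "cis (pi * of_int d / real N)"
    have "?z \<noteq> 1"
    proof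
      assume "?z = 1"
      then have "cos (pi * of_int d / real N) = 1" by (metis cis.sel(1) one_complex.sel(1))
      then obtain x :: int where "pi * of_int d / real N = of_int x * 2 * pi"
        by (auto simp: cos_one_2pi_int)
      then have "of_int d = (of_int (2 * int N * x) :: real)"
        using assms by (simp add: field_simps)
      then have "d = 2 * int N * x" by (simp only: of_int_eq_iff)
      moreover from this False have "\<bar>x\<bar> \<ge> 1" by auto
      ultimately have "\<bar>d\<bar> \<ge> 2 * int N"
        using mult_left_mono[of 1 "\<bar>x\<bar>" "int N"] by (simp add: abs_mult)
      with that show False by simp
    qed
    moreover have "?z ^ (2 * N) = 1"
    proof -
      have "?z ^ (2 * N) = cis (2 * pi * of_int d)"
        using assms by (simp only: Complex.DeMoivre) (simp add: field_simps)
      then show ?thesis by (simp add: cis_multiple_2pi)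
    qed
    moreover have "cis (pi * real k * of_int d / real N) = ?z ^ k" for k
      by (simp only: Complex.DeMoivre) (simp add: mult_ac)
    ultimately show ?thesis using False by (simp add: geometric_sum)
  qed
  have "complex_of_real (\<Sum>k<2 * N. (cmod (dft N w k))\<^sup>2)
      = (\<Sum>k<2 * N. dft N w k * cnj (dft N w k))"
    by (simp only: of_real_sum complex_norm_square)
  also have "\<dots> = (\<Sum>k<2 * N. \<Sum>l\<in>cell N. \<Sum>m\<in>cell N.
      of_real (w l * w m) * cis (pi * real k * of_int (m - l) / real N))"
  proof (intro sum.cong refl)
    fix k
    show "dft N w k * cnj (dft N w k) = (\<Sum>l\<in>cell N. \<Sum>m\<in>cell N.
        of_real (w l * w m) * cis (pi * real k * of_int (m - l) / real N))"
    proof -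
      have "(of_real (w l) * cis (- (pi * real k * of_int l / real N)))
          * cnj (of_real (w m) * cis (- (pi * real k * of_int m / real N)))
          = of_real (w l * w m) * cis (pi * real k * of_int (m - l) / real N)" for l m
      proof -
        have "cis (- (pi * real k * of_int l / real N)) * cis (pi * real k * of_int m / real N)
          = cis (pi * real k * of_int (m - l) / real N)"
          by (simp add: cis_mult algebra_simps diff_divide_distrib)
        then show ?thesis by (simp add: cis_cnj mult_ac)
      qed
      then show ?thesis
        by (simp only: dft_def cnj_sum sum_product)
    qed
  qed
  also have "\<dots> = (\<Sum>l\<in>cell N. \<Sum>m\<in>cell N.
      of_real (w l * w m) * (\<Sum>k<2 * N. cis (pi * real k * of_int (m - l) / real N)))"
    by (subst sum.swap, intro sum.cong refl, subst sum.swap) (simp only: sum_distrib_left)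
  also have "\<dots> = (\<Sum>l\<in>cell N. \<Sum>m\<in>cell N.
      if m = l then of_real (w l * w m) * of_nat (2 * N) else 0)"
  proof (intro sum.cong refl)
    fix l m assume "l \<in> cell N" "m \<in> cell N"
    then have "\<bar>m - l\<bar> < 2 * int N" by (auto simp: cell_def)
    from geo[OF this] show "of_real (w l * w m) *
        (\<Sum>k<2 * N. cis (pi * real k * of_int (m - l) / real N))
        = (if m = l then of_real (w l * w m) * of_nat (2 * N) else 0)"
      by simp
  qed
  also have "\<dots> = complex_of_real (2 * real N * (\<Sum>l\<in>cell N. (w l)\<^sup>2))"
    using fin by (simp add: sum_distrib_left power2_eq_square mult_ac)
  finally show ?thesis by (simp only: of_real_eq_iff)
qed

section \<open>Diagonalisation of the next-nearest neighbour form\<close>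

text \<open>Normal form of the second variation: \<open>g\<close>, \<open>p\<close>,
  \<open>q\<close> stand for the second derivative of \<open>G\<close> and the first derivatives of
  \<open>\<rho>\<close> at \<open>F\<close> and \<open>2 * F\<close>, while \<open>a\<close> and
  \<open>b\<close> collect the remaining first and second neighbour terms.\<close>

definition nnn_form :: "nat \<Rightarrow> real \<Rightarrow> real \<Rightarrow> real \<Rightarrow> real \<Rightarrow> real \<Rightarrow> (int \<Rightarrow> real) \<Rightarrow> real" where
  "nnn_form N g p q a b w = (\<Sum>l\<in>cell N.
     g * (p * (w l + w (l + 1)) + q * (w (l - 1) + w l + w (l + 1) + w (l + 2)))\<^sup>2
     + a * (w l)\<^sup>2 + b * (w l + w (l + 1))\<^sup>2)"

text \<open>
  With \<open>z = cis \<theta>\<close> the symbol of the shift and \<open>s = 2 - 2 cos \<theta>\<close>, the factors come from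
  \<open>|1 + z|\<^sup>2 = 4 - s\<close> and \<open>z\<^sup>-\<^sup>1 + 1 + z + z\<^sup>2 = (1 + z) (z + z\<^sup>-\<^sup>1)\<close>.
\<close>

definition nnn_symbol :: "real \<Rightarrow> real \<Rightarrow> real \<Rightarrow> real \<Rightarrow> real \<Rightarrow> real \<Rightarrow> real" where
  "nnn_symbol g p q a b s = g * ((4 - s) * (p + q * (2 - s))\<^sup>2) + a + b * (4 - s)"

lemma s_freq_cos: "2 - s_freq N k = 2 * cos (pi * real k / real N)"
proof -
  have "cos (pi * real k / real N) = cos (2 * (real k * pi / (2 * real N)))"
    by (simp add: mult.commute)
  also have "\<dots> = 1 - 2 * (sin (real k * pi / (2 * real N)))\<^sup>2"
    by (rule cos_double_sin)
  finally show ?thesis by (simp add: s_freq_def)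
qed

text \<open>Parseval is applied to each of the three squared sequences. Each is a combination of
  shifts of \<open>w\<close>, so its transform is that of \<open>w\<close> times a multiplier
  depending on \<open>k\<close> only.\<close>

lemma nnn_form_spectral:
  assumes N: "N \<ge> 1" and w: "periodic_seq N w"
  shows "2 * real N * nnn_form N g p q a b w
    = (\<Sum>k<2 * N. nnn_symbol g p q a b (s_freq N k) * (cmod (dft N w k))\<^sup>2)"
proof -
  let ?z = "\<lambda>k. cis (pi * real k / real N)"
  let ?c = "\<lambda>k. cos (pi * real k / real N)"
  let ?v = "\<lambda>l. w l + w (l + 1)"
  let ?x = "\<lambda>l. p * (w l + w (l + 1)) + q * (w (l - 1) + w l + w (l + 1) + w (l + 2))"
  have s1: "dft N (\<lambda>l. w (l + 1)) k = ?z k * dft N w k" for k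
    by (rule dft_shift[OF N w])
  have s2: "dft N (\<lambda>l. w (l + 2)) k = ?z k * (?z k * dft N w k)" for k
    using dft_shift[OF N periodic_seq_shift[OF w, of 1], of k] s1[of k]
    by (simp add: add.commute)
  have zc: "?z k * cnj (?z k) = 1" for k
    by (simp add: cis_cnj cis_mult)
  \<comment> \<open>A backward shift comes from applying the forward rule to the shifted sequence
    and inverting the phase.\<close>
  have "dft N w k = ?z k * dft N (\<lambda>l. w (l - 1)) k" for k
    using dft_shift[OF N periodic_seq_shift[OF w, of "-1"], of k] by simp
  then have s3: "dft N (\<lambda>l. w (l - 1)) k = cnj (?z k) * dft N w k" for k
    using zc[of k] by (simp add: mult.assoc[symmetric] mult.commute[of "cnj _"])
  have zre: "?z k + cnj (?z k) = of_real (2 * ?c k)" for k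
    by (simp add: complex_eq_iff)
  have n1: "(cmod (1 + ?z k))\<^sup>2 = 4 - s_freq N k" for k
  proof -
    have "(cmod (1 + ?z k))\<^sup>2 = 1 + 2 * ?c k + ((?c k)\<^sup>2 + (sin (pi * real k / real N))\<^sup>2)"
      by (simp add: cmod_power2 power2_sum)
    also have "\<dots> = 4 - s_freq N k"
      using s_freq_cos[of N k] by simp
    finally show ?thesis .
  qed
  have dv: "(cmod (dft N ?v k))\<^sup>2 = (4 - s_freq N k) * (cmod (dft N w k))\<^sup>2" for k
  proof -
    have "dft N ?v k = (1 + ?z k) * dft N w k"
      by (simp only: dft_add s1) (simp add: algebra_simps)
    then show ?thesis by (simp only: norm_mult power_mult_distrib n1)
  qed
  have dx: "(cmod (dft N ?x k))\<^sup>2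
      = (4 - s_freq N k) * (p + q * (2 - s_freq N k))\<^sup>2 * (cmod (dft N w k))\<^sup>2" for k
  proof -
    have "dft N ?x k = (of_real p * (1 + ?z k)
        + of_real q * (cnj (?z k) + 1 + ?z k + ?z k * ?z k)) * dft N w k"
      by (simp only: dft_add dft_cmult s1 s2 s3) (simp add: algebra_simps)
    also have "cnj (?z k) + 1 + ?z k + ?z k * ?z k = (1 + ?z k) * (?z k + cnj (?z k))"
      using zc[of k] by (simp add: algebra_simps)
    also have "of_real p * (1 + ?z k) + of_real q * ((1 + ?z k) * (?z k + cnj (?z k)))
        = (1 + ?z k) * of_real (p + q * (2 - s_freq N k))"
      unfolding zre s_freq_cos by (simp add: algebra_simps)
    finally show ?thesis
      by (simp only: norm_mult power_mult_distrib n1 norm_of_real power2_abs)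
  qed
  have "2 * real N * nnn_form N g p q a b w
      = g * (2 * real N * (\<Sum>l\<in>cell N. (?x l)\<^sup>2)) + a * (2 * real N * (\<Sum>l\<in>cell N. (w l)\<^sup>2))
        + b * (2 * real N * (\<Sum>l\<in>cell N. (?v l)\<^sup>2))"
    by (simp only: nnn_form_def sum.distrib sum_distrib_left[symmetric])
       (simp add: algebra_simps)
  also have "\<dots> = (\<Sum>k<2 * N. nnn_symbol g p q a b (s_freq N k) * (cmod (dft N w k))\<^sup>2)"
    unfolding dft_parseval[OF N, symmetric] dv dx
    unfolding sum_distrib_left nnn_symbol_def sum.distrib[symmetric]
    by (intro sum.cong refl) (simp add: algebra_simps)
  finally show ?thesis .
qed

section \<open>Lower bound and eigenvectors\<close>

text \<open>By \<open>sin (pi - x) = sin x\<close>, the modes \<open>k\<close> and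
  \<open>2 * N - k\<close> share an eigenvalue, so all nonzero modes are covered by the indices from
  1 to \<open>N\<close>.\<close>

lemma s_freq_reflect:
  assumes "N \<ge> 1" "k \<le> 2 * N"
  shows "s_freq N (2 * N - k) = s_freq N k"
proof -
  have "real (2 * N - k) * pi / (2 * real N) = pi - real k * pi / (2 * real N)"
    using assms by (simp add: of_nat_diff field_simps)
  then show ?thesis by (simp add: s_freq_def)
qed

text \<open>The mean-zero condition kills the mode \<open>k = 0\<close>, about which
  \<open>\<mu>\<close> says nothing; each other mode is bounded directly or by reflection.\<close>

lemma nnn_form_ge:
  assumes N: "N \<ge> 1" and w: "periodic_seq N w" "(\<Sum>l\<in>cell N. w l) = 0"
    and \<mu>: "\<And>k. 1 \<le> k \<Longrightarrow> k \<le> N \<Longrightarrow> \<mu> \<le> nnn_symbol g p q a b (s_freq N k)"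
  shows "\<mu> * (\<Sum>l\<in>cell N. (w l)\<^sup>2) \<le> nnn_form N g p q a b w"
proof -
  have "dft N w 0 = of_real (\<Sum>l\<in>cell N. w l)" by (simp add: dft_def)
  then have d0: "dft N w 0 = 0" using w by simp
  have "2 * real N * (\<mu> * (\<Sum>l\<in>cell N. (w l)\<^sup>2)) = (\<Sum>k<2 * N. \<mu> * (cmod (dft N w k))\<^sup>2)"
    using dft_parseval[OF N, of w] by (simp add: sum_distrib_left[symmetric])
  also have "\<dots> \<le> (\<Sum>k<2 * N. nnn_symbol g p q a b (s_freq N k) * (cmod (dft N w k))\<^sup>2)"
  proof (intro sum_mono)
    fix k assume "k \<in> {..<2 * N}"
    then consider "k = 0" | "1 \<le> k" "k \<le> N" | "1 \<le> 2 * N - k" "2 * N - k \<le> N" "k \<le> 2 * N"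
      by fastforce
    then show "\<mu> * (cmod (dft N w k))\<^sup>2
        \<le> nnn_symbol g p q a b (s_freq N k) * (cmod (dft N w k))\<^sup>2"
    proof cases
      case 1
      then show ?thesis using d0 by simp
    next
      case 2
      then show ?thesis by (intro mult_right_mono \<mu>) auto
    next
      case 3
      then show ?thesis
        using \<mu>[of "2 * N - k"] s_freq_reflect[OF N] by (intro mult_right_mono) auto
    qed
  qed
  also have "\<dots> = 2 * real N * nnn_form N g p q a b w"
    by (rule nnn_form_spectral[OF N w(1), symmetric])
  finally show ?thesis using N by simp
qed

lemma sum_cell_shift_square:
  fixes w :: "int \<Rightarrow> real"
  assumes w: "periodic_seq N w"
  shows "(\<Sum>l\<in>cell N. (w (l + 1))\<^sup>2) = (\<Sum>l\<in>cell N. (w l)\<^sup>2)"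
  using w by (intro sum_cell_shift[of "\<lambda>l. (w l)\<^sup>2"]) (simp add: periodic_seq_def)

text \<open>The hypothesis says that \<open>w\<close> is an eigenvector of the negative discrete
  Laplacian with eigenvalue \<open>s\<close>. Attainment thus follows by direct summation, without
  the Fourier transform.\<close>

lemma nnn_form_eigenvector:
  assumes w: "periodic_seq N w" and ev: "\<And>l. w (l + 1) + w (l - 1) = (2 - s) * w l"
  shows "nnn_form N g p q a b w = nnn_symbol g p q a b s * (\<Sum>l\<in>cell N. (w l)\<^sup>2)"
proof -
  have per: "w (l + 2 * int N) = w l" for l using w by (simp add: periodic_seq_def)
  have per': "w (l - 1 + 2 * int N) = w (l - 1)" for l by (rule per)
  have corr: "(\<Sum>l\<in>cell N. w l * w (l + 1)) = (\<Sum>l\<in>cell N. w (l - 1) * w l)"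
    using sum_cell_shift[of "\<lambda>l. w (l - 1) * w l" N] per per' by (simp add: algebra_simps)
  have "(\<Sum>l\<in>cell N. (w l + w (l + 1))\<^sup>2)
      = (\<Sum>l\<in>cell N. (w l)\<^sup>2) + (\<Sum>l\<in>cell N. (w (l + 1))\<^sup>2)
        + ((\<Sum>l\<in>cell N. w l * w (l + 1)) + (\<Sum>l\<in>cell N. w l * w (l + 1)))"
    by (simp add: power2_sum sum.distrib sum_distrib_left[symmetric] mult.assoc)
  also have "\<dots> = 2 * (\<Sum>l\<in>cell N. (w l)\<^sup>2)
        + ((\<Sum>l\<in>cell N. w l * w (l + 1)) + (\<Sum>l\<in>cell N. w (l - 1) * w l))"
    using sum_cell_shift_square[OF w] corr by simp
  also have "(\<Sum>l\<in>cell N. w l * w (l + 1)) + (\<Sum>l\<in>cell N. w (l - 1) * w l)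
      = (\<Sum>l\<in>cell N. w l * (w (l + 1) + w (l - 1)))"
    by (simp add: sum.distrib[symmetric] algebra_simps)
  also have "\<dots> = (2 - s) * (\<Sum>l\<in>cell N. (w l)\<^sup>2)"
    unfolding ev by (simp add: sum_distrib_left power2_eq_square mult_ac)
  finally have v: "(\<Sum>l\<in>cell N. (w l + w (l + 1))\<^sup>2) = (4 - s) * (\<Sum>l\<in>cell N. (w l)\<^sup>2)"
    by (simp add: algebra_simps)
  \<comment> \<open>The four-term sum regroups into the eigenvector relations at \<open>l\<close>
    and \<open>l + 1\<close>.\<close>
  have x: "p * (w l + w (l + 1)) + q * (w (l - 1) + w l + w (l + 1) + w (l + 2))
      = (p + q * (2 - s)) * (w l + w (l + 1))" for l
  proof -
    have "w (l - 1) + w (l + 1) + (w l + w (l + 2)) = (2 - s) * w l + (2 - s) * w (l + 1)"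
      using ev[of l] ev[of "l + 1"] by (simp add: add.commute)
    then have "w (l - 1) + w l + w (l + 1) + w (l + 2) = (2 - s) * (w l + w (l + 1))"
      by (simp add: algebra_simps)
    then show ?thesis by (simp only:) (simp add: algebra_simps)
  qed
  show ?thesis
    unfolding nnn_form_def x power_mult_distrib sum.distrib sum_distrib_left[symmetric] v
      nnn_symbol_def
    by (simp add: algebra_simps sum_distrib_left[symmetric] v)
qed

lemma periodic_seq_bdiff:
  assumes "u \<in> displacements N"
  shows "periodic_seq N (bdiff N u)"
proof -
  have "u (l + 2 * int N - 1) = u (l - 1)" for l
    using assms by (simp add: displacements_def algebra_simps) (metis add_diff_eq diff_add_eq)
  then show ?thesis
    using assms by (simp add: displacements_def periodic_seq_def bdiff_def)
qed

lemma sum_bdiff: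
  assumes "u \<in> displacements N"
  shows "(\<Sum>l\<in>cell N. bdiff N u l) = 0"
proof -
  have "periodic_seq N u" using assms by (simp add: displacements_def periodic_seq_def)
  from periodic_seq_shift[OF this, of "-1"]
  have "(\<Sum>l\<in>cell N. u l) = (\<Sum>l\<in>cell N. u (l - 1))"
    using sum_cell_shift[of "\<lambda>l. u (l - 1)" N] by (simp add: periodic_seq_def)
  then show ?thesis
    by (simp add: bdiff_def sum_divide_distrib[symmetric] sum_subtractf)
qed

section \<open>The minimum eigenvalue\<close>

locale eam_chain =
  fixes \<phi> \<rho> G :: "real \<Rightarrow> real" and F :: real
  assumes smooth: "smooth_fun_on {0<..} \<phi>" "smooth_fun_on {0<..} \<rho>" "smooth_fun_on UNIV G"
    and F_pos: "F > 0"
begin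

abbreviation "form N \<equiv> nnn_form N ((deriv ^^ 2) G (rho_bar_F \<rho> F)) (deriv \<rho> F) (deriv \<rho> (2 * F))
   (2 * deriv G (rho_bar_F \<rho> F) * (deriv ^^ 2) \<rho> F + (deriv ^^ 2) \<phi> F)
   (2 * deriv G (rho_bar_F \<rho> F) * (deriv ^^ 2) \<rho> (2 * F) + (deriv ^^ 2) \<phi> (2 * F))"

abbreviation "symbol \<equiv> nnn_symbol ((deriv ^^ 2) G (rho_bar_F \<rho> F)) (deriv \<rho> F) (deriv \<rho> (2 * F))
   (2 * deriv G (rho_bar_F \<rho> F) * (deriv ^^ 2) \<rho> F + (deriv ^^ 2) \<phi> F)
   (2 * deriv G (rho_bar_F \<rho> F) * (deriv ^^ 2) \<rho> (2 * F) + (deriv ^^ 2) \<phi> (2 * F))"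

text \<open>Expanding the factored symbol in powers of \<open>s\<close> produces the four
  coefficients; for instance the leading one is \<open>- g * q\<^sup>2\<close>.\<close>

lemma lambda_a_eq: "lambda_a \<phi> \<rho> G F s = symbol s"
  unfolding lambda_a_def nnn_symbol_def A_coeff_def B_coeff_def C_coeff_def D_coeff_def
  by (simp add: algebra_simps power2_eq_square power3_eq_cube)

text \<open>Squares at shifted sites have equal sums over a period, so paired terms merge; this
  doubles the \<open>\<rho>\<close> terms and absorbs the factor \<open>1 / 2\<close> of the
  \<open>\<phi>\<close> terms.\<close>

lemma second_variation_a_form:
  assumes N: "N \<ge> 1" and u: "u \<in> displacements N"
  shows "second_variation_a \<phi> \<rho> G F N u = lattice_eps N * form N (bdiff N u)"
proof -
  define w where "w = bdiff N u"
  have w: "periodic_seq N w" using periodic_seq_bdiff[OF u] by (simp add: w_def)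
  let ?v = "\<lambda>l. w l + w (l + 1)"
  have v: "periodic_seq N (\<lambda>l. w (l + c) + w (l + d))" for c d
    using periodic_seq_shift[OF w, of c] periodic_seq_shift[OF w, of d]
    by (simp add: periodic_seq_def)
  have s1: "(\<Sum>l\<in>cell N. (w (l + 1))\<^sup>2) = (\<Sum>l\<in>cell N. (w l)\<^sup>2)"
    by (rule sum_cell_shift_square[OF w])
  have s2: "(\<Sum>l\<in>cell N. (w (l + 1) + w (l + 2))\<^sup>2) = (\<Sum>l\<in>cell N. (?v l)\<^sup>2)"
    using sum_cell_shift_square[OF v[of 0 1]] by (simp add: add.commute)
  have s3: "(\<Sum>l\<in>cell N. (w l + w (l - 1))\<^sup>2) = (\<Sum>l\<in>cell N. (?v l)\<^sup>2)"
    using sum_cell_shift_square[OF v[of 0 "-1"]] by (simp add: add.commute)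
  show ?thesis
    unfolding second_variation_a_eq[OF smooth F_pos N] nnn_form_def w_def[symmetric]
      sum.distrib sum_distrib_left[symmetric] s1 s2 s3
    by (simp add: algebra_simps)
qed

lemma l2_eps_norm_eq_1:
  assumes "l2_eps_norm N w = 1"
  shows "lattice_eps N * (\<Sum>l\<in>cell N. (w l)\<^sup>2) = 1"
  using assms by (simp add: l2_eps_norm_def)

lemma second_variation_a_ge:
  assumes N: "N \<ge> 1" and u: "u \<in> displacements N" "l2_eps_norm N (bdiff N u) = 1"
    and \<mu>: "\<And>k. 1 \<le> k \<Longrightarrow> k \<le> N \<Longrightarrow> \<mu> \<le> lambda_a \<phi> \<rho> G F (s_freq N k)"
  shows "\<mu> \<le> second_variation_a \<phi> \<rho> G F N u"
proof -
  have "\<mu> * (\<Sum>l\<in>cell N. (bdiff N u l)\<^sup>2) \<le> form N (bdiff N u)"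
    using \<mu> unfolding lambda_a_eq
    by (intro nnn_form_ge N periodic_seq_bdiff sum_bdiff u)
  then have "lattice_eps N * (\<mu> * (\<Sum>l\<in>cell N. (bdiff N u l)\<^sup>2)) \<le> lattice_eps N * form N (bdiff N u)"
    by (intro mult_left_mono) (simp_all add: lattice_eps_def)
  then show ?thesis
    using l2_eps_norm_eq_1[OF u(2)] second_variation_a_form[OF N u(1)]
    by (metis mult.left_commute mult.right_neutral)
qed

text \<open>The minimising candidate is a cosine wave scaled to unit norm. A cosine serves for every
  \<open>k\<close>, whereas the sine would vanish on all lattice points when
  \<open>k = N\<close>.\<close>

lemma lambda_a_attained:
  assumes N: "N \<ge> 1" and k: "1 \<le> k" "k \<le> N"
  shows "lambda_a \<phi> \<rho> G F (s_freq N k) \<in> second_variation_a \<phi> \<rho> G F N `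
     {u \<in> displacements N. l2_eps_norm N (bdiff N u) = 1}"
proof -
  define \<theta> where "\<theta> = pi * real k / real N"
  define u0 :: "int \<Rightarrow> real" where "u0 l = cos (\<theta> * of_int l)" for l
  define w0 where "w0 = bdiff N u0"
  define S where "S = lattice_eps N * (\<Sum>l\<in>cell N. (w0 l)\<^sup>2)"
  define u where "u l = u0 l / sqrt S" for l
  have eps: "lattice_eps N > 0" using N by (simp add: lattice_eps_def)
  have s: "2 - s_freq N k = 2 * cos \<theta>" by (simp add: s_freq_cos \<theta>_def)
  have cos1: "cos \<theta> \<noteq> 1"
  proof -
    have "cos \<theta> < cos 0"
      using N k by (intro cos_monotone_0_pi) (auto simp: \<theta>_def field_simps)
    then show ?thesis by simp
  qed
  have ev0: "u0 (l + 1) + u0 (l - 1) = 2 * cos \<theta> * u0 l" for l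
    by (simp add: u0_def distrib_left right_diff_distrib cos_add cos_diff)
  have per0: "u0 (l + 2 * int N) = u0 l" for l
  proof -
    have "\<theta> * of_int (l + 2 * int N) = \<theta> * of_int l + 2 * real k * pi"
      using N by (simp add: \<theta>_def field_simps)
    then show ?thesis by (simp add: u0_def cos_add sin_npi2 cos_npi2)
  qed
  \<comment> \<open>Summing the eigenvector relation over a period gives
    \<open>2 * cos \<theta>\<close> times the sum on one side and twice the sum on the other; as
    \<open>cos \<theta> \<noteq> 1\<close>, the mean is zero.\<close>
  have "(\<Sum>l\<in>cell N. u0 (l + 1)) = (\<Sum>l\<in>cell N. u0 l)"
    by (rule sum_cell_shift) (rule per0)
  moreover have "(\<Sum>l\<in>cell N. u0 l) = (\<Sum>l\<in>cell N. u0 (l - 1))"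
    using sum_cell_shift[of "\<lambda>l. u0 (l - 1)" N] per0[of "_ - 1"] by (simp add: algebra_simps)
  ultimately have "2 * (\<Sum>l\<in>cell N. u0 l) = (\<Sum>l\<in>cell N. u0 (l + 1) + u0 (l - 1))"
    by (simp add: sum.distrib)
  also have "\<dots> = 2 * cos \<theta> * (\<Sum>l\<in>cell N. u0 l)"
    unfolding ev0 by (simp add: sum_distrib_left)
  finally have "(1 - cos \<theta>) * (\<Sum>l\<in>cell N. u0 l) = 0" by (simp add: algebra_simps)
  with cos1 have sum0: "(\<Sum>l\<in>cell N. u0 l) = 0" by simp
  \<comment> \<open>The strain at site 1 is \<open>(cos \<theta> - 1)\<close> over the lattice
    spacing, so the wave has positive norm and can be normalised.\<close>
  have "w0 1 \<noteq> 0" using cos1 eps by (simp add: w0_def bdiff_def u0_def)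
  moreover have "1 \<in> cell N" using N by (simp add: cell_def)
  ultimately have "(\<Sum>l\<in>cell N. (w0 l)\<^sup>2) > 0"
    by (intro sum_pos2[of _ 1]) (auto simp: cell_def)
  then have S: "S > 0" using eps by (simp add: S_def)
  have u: "u \<in> displacements N"
    using per0 sum0 by (simp add: displacements_def u_def sum_divide_distrib[symmetric])
  have wu: "bdiff N u l = w0 l / sqrt S" for l
    by (simp add: bdiff_def w0_def u_def diff_divide_distrib mult.commute)
  have n: "lattice_eps N * (\<Sum>l\<in>cell N. (bdiff N u l)\<^sup>2) = 1"
  proof -
    have "lattice_eps N * (\<Sum>l\<in>cell N. (bdiff N u l)\<^sup>2) = S / (sqrt S)\<^sup>2"
      by (simp only: wu power_divide sum_divide_distrib[symmetric] S_def times_divide_eq_right)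
    also have "\<dots> = 1" using S by simp
    finally show ?thesis .
  qed
  then have norm: "l2_eps_norm N (bdiff N u) = 1"
    by (simp add: l2_eps_norm_def)
  have "bdiff N u (l + 1) + bdiff N u (l - 1) = (2 - s_freq N k) * bdiff N u l" for l
  proof -
    have "u0 l + u0 (l - 2) = 2 * cos \<theta> * u0 (l - 1)" using ev0[of "l - 1"] by simp
    moreover have "w0 (l + 1) + w0 (l - 1)
        = ((u0 (l + 1) + u0 (l - 1)) - (u0 l + u0 (l - 2))) / lattice_eps N"
      by (simp add: w0_def bdiff_def add_divide_distrib[symmetric])
    ultimately have "w0 (l + 1) + w0 (l - 1) = 2 * cos \<theta> * w0 l"
      using ev0[of l] by (simp add: w0_def bdiff_def right_diff_distrib)
    then show ?thesis
      unfolding wu s by (simp add: add_divide_distrib[symmetric])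
  qed
  from nnn_form_eigenvector[OF periodic_seq_bdiff[OF u] this]
  have "second_variation_a \<phi> \<rho> G F N u = symbol (s_freq N k)"
    using n second_variation_a_form[OF N u] by (simp add: mult.left_commute)
  then show ?thesis using u norm by (auto simp: lambda_a_eq image_iff)
qed

lemma is_min_eigenvalue_a_lambda:
  assumes "N \<ge> 1" "1 \<le> k" "k \<le> N"
  shows "is_min_eigenvalue_a \<phi> \<rho> G F N (lambda_a \<phi> \<rho> G F (s_freq N k)) \<longleftrightarrow>
     (\<forall>j. 1 \<le> j \<and> j \<le> N \<longrightarrow> lambda_a \<phi> \<rho> G F (s_freq N k) \<le> lambda_a \<phi> \<rho> G F (s_freq N j))"
    (is "?L \<longleftrightarrow> ?R")
proof
  show ?L if ?R
    unfolding is_min_eigenvalue_a_def Let_def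
    using that lambda_a_attained[OF assms] assms(1) by (auto intro!: second_variation_a_ge)
  show ?R if ?L
    using that lambda_a_attained[OF assms(1)]
    unfolding is_min_eigenvalue_a_def Let_def by blast
qed

end

section \<open>Minimising a cubic over the frequency grid\<close>

lemma s_freq_strict_mono:
  assumes "N \<ge> 1" "j < k" "k \<le> N"
  shows "s_freq N j < s_freq N k"
proof -
  have "cos (pi * real k / real N) < cos (pi * real j / real N)"
    using assms by (intro cos_monotone_0_pi) (auto simp: field_simps)
  then show ?thesis using s_freq_cos[of N j] s_freq_cos[of N k] by simp
qed

lemma s_freq_le:
  assumes "N \<ge> 1"
  shows "s_freq N k \<le> (real k * pi / real N)\<^sup>2"
proof -
  have "(sin (real k * pi / (2 * real N)))\<^sup>2 \<le> (real k * pi / (2 * real N))\<^sup>2"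
    using abs_sin_x_le_abs_x[of "real k * pi / (2 * real N)"] by (simp only: abs_le_square_iff)
  then show ?thesis by (simp add: s_freq_def power_divide)
qed

lemma s_freq_Suc_diff_le:
  assumes "N \<ge> 1"
  shows "s_freq N (Suc k) - s_freq N k \<le> (2 * real k + 1) * pi\<^sup>2 * (lattice_eps N)\<^sup>2"
proof -
  \<comment> \<open>Midpoint and half-distance of the two angles: the difference of cosines becomes
    a product of sines, which keeps the bound linear in \<open>k\<close>.\<close>
  let ?x = "(2 * real k + 1) * pi / (2 * real N)" and ?y = "pi / (2 * real N)"
  have "s_freq N (Suc k) - s_freq N k = 2 * (cos (?x - ?y) - cos (?x + ?y))"
  proof -
    have "pi * real k / real N = ?x - ?y" "pi * real (Suc k) / real N = ?x + ?y"
      using assms by (simp_all add: field_simps)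
    then show ?thesis using s_freq_cos[of N k] s_freq_cos[of N "Suc k"] by simp
  qed
  also have "\<dots> = 4 * (sin ?x * sin ?y)" by (simp add: cos_add cos_diff)
  also have "\<dots> \<le> 4 * (\<bar>sin ?x\<bar> * \<bar>sin ?y\<bar>)" by (simp add: abs_mult[symmetric])
  also have "\<dots> \<le> 4 * (?x * ?y)"
    using abs_sin_x_le_abs_x[of ?x] abs_sin_x_le_abs_x[of ?y]
    by (intro mult_left_mono mult_mono) (simp_all add: abs_of_nonneg)
  also have "\<dots> = (2 * real k + 1) * pi\<^sup>2 * (lattice_eps N)\<^sup>2"
    using assms by (simp add: lattice_eps_def field_simps power2_eq_square)
  finally show ?thesis .
qed

text \<open>For \<open>D < 0\<close> the derivative is a downward parabola, so the cubic decreases,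
  increases between the critical points if there are two, and decreases again. The smaller critical
  point is \<open>t\<close>, and a point \<open>y\<close> not above its neighbours confines it to
  the interval from \<open>x\<close> to \<open>z\<close>.\<close>

lemma cubic_min_dichotomy:
  fixes A B C D :: real
  defines "f \<equiv> \<lambda>s. A + B * s + C * s\<^sup>2 + D * s ^ 3"
    and "t \<equiv> (C - sqrt (C\<^sup>2 - 3 * B * D)) / (- 3 * D)"
  assumes B: "B < 0" and D: "D < 0"
    and le: "f y \<le> f x" "f y \<le> f z" and ord: "0 \<le> x" "x < y" "y < z"
  shows "C\<^sup>2 - 3 * B * D \<ge> 0 \<and> x \<le> t \<and> t \<le> z"
proof -
  have der: "(f has_real_derivative B + 2 * C * s + 3 * D * s\<^sup>2) (at s)" for s
    unfolding f_def
    by (auto intro!: derivative_eq_intros simp: power2_eq_square algebra_simps)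
  have dec: "f b < f a"
    if "a < b" and "\<And>s. a < s \<Longrightarrow> s < b \<Longrightarrow> B + 2 * C * s + 3 * D * s\<^sup>2 < 0" for a b
  proof (rule DERIV_neg_imp_decreasing_open[OF that(1)])
    show "continuous_on {a..b} f"
      by (meson DERIV_isCont der continuous_at_imp_continuous_on)
  qed (use that der in blast)
  have inc: "f a < f b"
    if "a < b" and "\<And>s. a < s \<Longrightarrow> s < b \<Longrightarrow> B + 2 * C * s + 3 * D * s\<^sup>2 > 0" for a b
  proof (rule DERIV_pos_imp_increasing_open[OF that(1)])
    show "continuous_on {a..b} f"
      by (meson DERIV_isCont der continuous_at_imp_continuous_on)
  qed (use that der in blast)
  show ?thesis
  proof (cases "C\<^sup>2 - 3 * B * D \<ge> 0")
    case False
    have "B + 2 * C * s + 3 * D * s\<^sup>2 < 0" for s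
    proof -
      \<comment> \<open>Completing the square: without real critical points, the negative factor
        \<open>3 * D\<close> makes the derivative negative everywhere.\<close>
      have "3 * D * (B + 2 * C * s + 3 * D * s\<^sup>2) = (3 * D * s + C)\<^sup>2 - (C\<^sup>2 - 3 * B * D)"
        by (simp add: power2_eq_square algebra_simps)
      also have "\<dots> > 0" using False zero_le_power2[of "3 * D * s + C"]
        by linarith
      finally show ?thesis using D by (simp add: zero_less_mult_iff)
    qed
    then have "f z < f y" using ord by (intro dec) auto
    with le show ?thesis by simp
  next
    case True
    define r where "r = sqrt (C\<^sup>2 - 3 * B * D)"
    \<comment> \<open>The larger critical point, beyond which the cubic decreases.\<close>
    define t' where "t' = (C + r) / (- 3 * D)"
    have r: "r\<^sup>2 = C\<^sup>2 - 3 * B * D" "r \<ge> 0" using True by (simp_all add: r_def)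
    have t: "t = (C - r) / (- 3 * D)" by (simp add: t_def r_def)
    have tt: "t \<le> t'" unfolding t t'_def using D r by (intro divide_right_mono) auto
    have Ct: "C = - 3 * D * t + r" and Ct': "C = - 3 * D * t' - r"
      using D by (simp_all add: t t'_def field_simps)
    have fac: "B + 2 * C * s + 3 * D * s\<^sup>2 = 3 * D * (s - t) * (s - t')" for s
    proof -
      have "3 * D * (t + t') = - 2 * C" using Ct Ct' by (simp add: algebra_simps)
      moreover have "3 * D * (t * t') = B"
      proof -
        have "(3 * D) * (3 * D * (t * t')) = (C - r) * (C + r)"
          using D by (simp add: t t'_def field_simps)
        also have "\<dots> = C\<^sup>2 - r\<^sup>2" by (simp add: power2_eq_square algebra_simps)
        also have "\<dots> = (3 * D) * B" unfolding r by simp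
        finally show ?thesis using D by simp
      qed
      moreover have "3 * D * (s - t) * (s - t')
          = 3 * D * s\<^sup>2 - (3 * D * (t + t')) * s + 3 * D * (t * t')"
        by (simp add: power2_eq_square algebra_simps)
      ultimately show ?thesis by simp
    qed
    have neg: "B + 2 * C * s + 3 * D * s\<^sup>2 < 0" if "s < t \<or> t' < s" for s
    proof -
      have "(s - t) * (s - t') > 0" using that tt by (auto intro: mult_neg_neg mult_pos_pos)
      then have "3 * D * ((s - t) * (s - t')) < 0" using D by (simp add: mult_neg_pos)
      then show ?thesis unfolding fac by (simp only: mult.assoc)
    qed
    have pos: "B + 2 * C * s + 3 * D * s\<^sup>2 > 0" if "t < s" "s < t'" for s
    proof -
      have "(s - t) * (s - t') < 0" using that by (auto intro: mult_pos_neg)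
      then have "3 * D * ((s - t) * (s - t')) > 0" using D by (simp add: mult_neg_neg)
      then show ?thesis unfolding fac by (simp only: mult.assoc)
    qed
    have "y \<le> t'"
    proof (rule ccontr)
      assume "\<not> y \<le> t'"
      then have "f z < f y" using ord by (intro dec neg) auto
      with le show False by simp
    qed
    have "t \<le> z"
    proof (rule ccontr)
      assume "\<not> t \<le> z"
      then have "f z < f y" using ord by (intro dec neg) auto
      with le show False by simp
    qed
    \<comment> \<open>If \<open>t < x\<close>, then \<open>y \<le> t'\<close> puts the whole stretch
      from \<open>x\<close> to \<open>y\<close> where the cubic increases, contradicting the choice
      of \<open>y\<close>.\<close>
    moreover have "x \<le> t"
    proof (rule ccontr)
      assume "\<not> x \<le> t"
      then have "f x < f y" using ord \<open>y \<le> t'\<close> by (intro inc pos) auto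
      with le show False by simp
    qed
    ultimately show ?thesis using True by simp
  qed
qed

text \<open>The derivative at 0 is \<open>B < 0\<close> and stays negative nearby by
  continuity.\<close>

lemma cubic_decreasing_near_0:
  fixes A B C D :: real
  assumes "B < 0"
  obtains \<delta> where "\<delta> > 0" "\<And>x y. 0 \<le> x \<Longrightarrow> x < y \<Longrightarrow> y \<le> \<delta> \<Longrightarrow>
     A + B * y + C * y\<^sup>2 + D * y ^ 3 < A + B * x + C * x\<^sup>2 + D * x ^ 3"
proof -
  let ?f = "\<lambda>s. A + B * s + C * s\<^sup>2 + D * s ^ 3" and ?g = "\<lambda>s. B + 2 * C * s + 3 * D * s\<^sup>2"
  have der: "(?f has_real_derivative ?g s) (at s)" for s
    by (auto intro!: derivative_eq_intros simp: power2_eq_square algebra_simps)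
  have "isCont ?g 0" by (intro continuous_intros)
  then have "((\<lambda>s. ?g s) \<longlongrightarrow> ?g 0) (nhds 0)" by (simp add: continuous_at tendsto_nhds_iff)
  then have "\<forall>\<^sub>F s in nhds 0. ?g s < 0"
    using assms by (intro order_tendstoD(2)) auto
  then obtain d where d: "d > 0" "\<And>s. dist s 0 < d \<Longrightarrow> ?g s < 0"
    by (auto simp: eventually_nhds_metric)
  show thesis
  \<comment> \<open>Halving \<open>d\<close> keeps the closed range up to \<open>\<delta>\<close>
    inside the open ball.\<close>
  proof (rule that[of "d / 2"])
    fix x y :: real assume "0 \<le> x" "x < y" "y \<le> d / 2"
    then have "?g s < 0" if "x \<le> s" "s \<le> y" for s
      using d that by (intro d(2)) (auto simp: dist_real_def)
    with der show "?f y < ?f x"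
      by (intro DERIV_neg_imp_decreasing[OF \<open>x < y\<close>]) blast
  qed (use d in simp)
qed

section \<open>Choice of the constants and assembly\<close>

theorem theorem4p2:
  fixes \<phi> \<rho> G :: "real \<Rightarrow> real" and F :: real
  assumes "smooth_fun_on {0<..} \<phi>" and "smooth_fun_on {0<..} \<rho>" and "smooth_fun_on UNIV G"
    and "F > 0"
    and "(deriv ^^ 2) \<phi> F > 0" and "(deriv ^^ 2) \<phi> (2 * F) < 0"
    and "deriv \<rho> F \<le> 0" and "deriv \<rho> (2 * F) \<le> 0"
    and "(deriv ^^ 2) \<rho> F \<ge> 0" and "(deriv ^^ 2) \<rho> (2 * F) \<ge> 0"
    and "(deriv ^^ 2) G (rho_bar_F \<rho> F) \<ge> 0"
    and "B_coeff \<phi> \<rho> G F < 0"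
  shows "\<exists>(N0::nat) (K::real). \<forall>N::nat. N \<ge> 1 \<and> N \<ge> N0 \<longrightarrow>
    \<not> is_min_eigenvalue_a \<phi> \<rho> G F N (lambda_a \<phi> \<rho> G F (s_freq N 1)) \<and>
    (\<exists>k::nat. 1 < k \<and> k \<le> N \<and>
       is_min_eigenvalue_a \<phi> \<rho> G F N (lambda_a \<phi> \<rho> G F (s_freq N k)) \<and>
       (s_freq N k = 4 \<or>
        (D_coeff \<rho> G F \<noteq> 0 \<and> discr \<phi> \<rho> G F \<ge> 0 \<and>
         \<bar>s_freq N k - s_star \<phi> \<rho> G F\<bar> \<le> K * (2 * real k * (lattice_eps N)\<^sup>2))))"
proof -
  interpret eam_chain \<phi> \<rho> G F by unfold_locales (use assms in auto)
  let ?B = "B_coeff \<phi> \<rho> G F" and ?C = "C_coeff \<rho> G F" and ?D = "D_coeff \<rho> G F"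
  let ?lam = "lambda_a \<phi> \<rho> G F" and ?t = "s_star \<phi> \<rho> G F"
  obtain \<delta> where \<delta>: "\<delta> > 0" "\<And>x y. 0 \<le> x \<Longrightarrow> x < y \<Longrightarrow> y \<le> \<delta> \<Longrightarrow> ?lam y < ?lam x"
    using cubic_decreasing_near_0[OF assms(12), where A = "A_coeff \<phi> \<rho> G F" and C = "?C" and D = "?D"]
    unfolding lambda_a_def by metis
  \<comment> \<open>For \<open>N \<ge> M\<close> the bound
    \<open>(2 * pi)\<^sup>2 / N\<^sup>2\<close> on the second frequency, weakened to
    \<open>(2 * pi)\<^sup>2 / N\<close>, is at most \<open>\<delta>\<close>.\<close>
  obtain M :: nat where M: "(2 * pi)\<^sup>2 / \<delta> < real M" using reals_Archimedean2 by blast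
  \<comment> \<open>The lower bound 2 on \<open>N\<close> puts index 2 on the grid. The constant
    arises from \<open>2 * k + 1 \<le> 3 * k\<close> in the grid spacing, rewritten as a multiple of
    \<open>2 * k\<close>.\<close>
  have main: "\<not> is_min_eigenvalue_a \<phi> \<rho> G F N (?lam (s_freq N 1)) \<and>
    (\<exists>k. 1 < k \<and> k \<le> N \<and> is_min_eigenvalue_a \<phi> \<rho> G F N (?lam (s_freq N k)) \<and>
       (s_freq N k = 4 \<or> (?D \<noteq> 0 \<and> discr \<phi> \<rho> G F \<ge> 0 \<and>
         \<bar>s_freq N k - ?t\<bar> \<le> (3 / 2 * pi\<^sup>2) * (2 * real k * (lattice_eps N)\<^sup>2))))"
    if "N \<ge> 1" "N \<ge> max 2 M" for N
  proof -
    have N: "N \<ge> 1" "N \<ge> 2" "N \<ge> M" using that by auto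
    have s0: "0 \<le> s_freq N k" for k by (simp add: s_freq_def)
    have s12: "s_freq N 1 < s_freq N 2" using N by (intro s_freq_strict_mono) auto
    have "s_freq N 2 \<le> (2 * pi)\<^sup>2 / (real N)\<^sup>2"
      using s_freq_le[OF N(1), of 2] by (simp add: power_divide)
    also have "\<dots> \<le> (2 * pi)\<^sup>2 / real N"
      using N by (intro divide_left_mono) (auto simp: power2_eq_square)
    also have "\<dots> \<le> \<delta>"
    proof -
      have "(2 * pi)\<^sup>2 < real N * \<delta>"
        using less_le_trans[OF M, of "real N"] N(3) \<delta>(1) by (simp add: pos_divide_less_eq)
      then show ?thesis using N by (simp add: field_simps)
    qed
    finally have lam12: "?lam (s_freq N 2) < ?lam (s_freq N 1)"
      using s12 s0 by (intro \<delta>(2)) auto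
    have "\<exists>k\<in>{1..N}. \<forall>j\<in>{1..N}. ?lam (s_freq N k) \<le> ?lam (s_freq N j)"
      using ex_is_arg_min_if_finite[of "{1..N}" "\<lambda>k. ?lam (s_freq N k)"] N
      unfolding is_arg_min_linorder by force
    then obtain k where k: "1 \<le> k" "k \<le> N"
      and min: "\<And>j. 1 \<le> j \<Longrightarrow> j \<le> N \<Longrightarrow> ?lam (s_freq N k) \<le> ?lam (s_freq N j)"
      by auto
    have "k \<noteq> 1" using min[of 2] lam12 N by auto
    with k have k1: "1 < k" by simp
    have dich: "s_freq N k = 4 \<or> (?D \<noteq> 0 \<and> discr \<phi> \<rho> G F \<ge> 0 \<and>
         \<bar>s_freq N k - ?t\<bar> \<le> (3 / 2 * pi\<^sup>2) * (2 * real k * (lattice_eps N)\<^sup>2))"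
    proof (cases "k = N")
      case True
      then have "s_freq N k = 4" using N s_freq_cos[of N N] by simp
      then show ?thesis ..
    next
      case False
      \<comment> \<open>An interior minimiser: both \<open>k - 1\<close> and \<open>Suc k\<close>
        lie between 1 and \<open>N\<close>, so both neighbours are available for comparison.\<close>
      with k have kN: "Suc k \<le> N" by simp
      have up: "s_freq N k < s_freq N (Suc k)" using N kN by (intro s_freq_strict_mono) auto
      have dn: "s_freq N (k - 1) < s_freq N k" using N k k1 by (intro s_freq_strict_mono) auto
      have lup: "?lam (s_freq N k) \<le> ?lam (s_freq N (Suc k))" using kN by (intro min) auto
      have ldn: "?lam (s_freq N k) \<le> ?lam (s_freq N (k - 1))" using k k1 by (intro min) auto
      \<comment> \<open>If \<open>?D\<close> vanishes, so does one of its two factors, and both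
        occur in \<open>?C\<close>. Then the symbol is affine with negative slope and its value at
        \<open>Suc k\<close> would be smaller.\<close>
      have "?D \<noteq> 0"
      proof
        assume "?D = 0"
        then have "?C = 0" by (auto simp: C_coeff_def D_coeff_def)
        with \<open>?D = 0\<close> lup have "?B * s_freq N k \<le> ?B * s_freq N (Suc k)"
          by (simp add: lambda_a_def)
        with up assms(12) show False by (simp add: mult_le_cancel_left)
      qed
      moreover have "?D \<le> 0" using assms(11) by (simp add: D_coeff_def)
      ultimately have D: "?D < 0" by simp
      have c: "discr \<phi> \<rho> G F \<ge> 0 \<and> s_freq N (k - 1) \<le> ?t \<and> ?t \<le> s_freq N (Suc k)"
        unfolding s_star_def discr_def
        by (rule cubic_min_dichotomy[OF assms(12) D ldn[unfolded lambda_a_def]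
              lup[unfolded lambda_a_def] s0 dn up])
      let ?e = "(lattice_eps N)\<^sup>2"
      have "s_freq N (Suc k) - s_freq N k \<le> (2 * real k + 1) * (pi\<^sup>2 * ?e)"
        using s_freq_Suc_diff_le[OF N(1), of k] by (simp add: mult.assoc)
      also have "\<dots> \<le> (3 * real k) * (pi\<^sup>2 * ?e)" using k by (intro mult_right_mono) auto
      finally have a: "s_freq N (Suc k) - s_freq N k \<le> (3 * real k) * (pi\<^sup>2 * ?e)" .
      have "s_freq N k - s_freq N (k - 1) \<le> (2 * real (k - 1) + 1) * (pi\<^sup>2 * ?e)"
        using s_freq_Suc_diff_le[OF N(1), of "k - 1"] k1 by (simp add: mult.assoc)
      also have "\<dots> \<le> (3 * real k) * (pi\<^sup>2 * ?e)" using k by (intro mult_right_mono) auto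
      finally have b: "s_freq N k - s_freq N (k - 1) \<le> (3 * real k) * (pi\<^sup>2 * ?e)" .
      \<comment> \<open>The critical point lies between the two neighbouring frequencies, so its
        distance to the middle one is at most the larger gap.\<close>
      have "\<bar>s_freq N k - ?t\<bar> \<le> (3 * real k) * (pi\<^sup>2 * ?e)" using a b c by linarith
      with D c show ?thesis by (simp add: mult_ac)
    qed
    have "is_min_eigenvalue_a \<phi> \<rho> G F N (?lam (s_freq N k))"
      using is_min_eigenvalue_a_lambda[OF N(1) k] min by blast
    moreover have "\<not> is_min_eigenvalue_a \<phi> \<rho> G F N (?lam (s_freq N 1))"
    proof
      assume "is_min_eigenvalue_a \<phi> \<rho> G F N (?lam (s_freq N 1))"
      then have "?lam (s_freq N 1) \<le> ?lam (s_freq N 2)"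
        using is_min_eigenvalue_a_lambda[OF N(1), of 1] N by simp
      with lam12 show False by simp
    qed
    ultimately show ?thesis using k k1 dich by blast
  qed
  show ?thesis
    by (rule exI[of _ "max 2 M"], rule exI[of _ "3 / 2 * pi\<^sup>2"]) (use main in blast)
qed

end
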